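(* Let $f\neq 1$ be a positive integer and let $S=\mathrm{PSL}(2,3^f)$. Let $g\in \mathrm{PGL}(2,3^f)\setminus \mathrm{PSL}(2,3^f)$ and let $\phi$ be the Frobenius automorphism of $S$ of order $f$. Then $\alpha=g\phi \in \mathrm{Aut}(S)$ and all the elements of the coset $\alpha S$ have order dividing $4f$. In particular, if $f$ is a power of $2$, then $\alpha S$ contains only $2$-elements.
   Context: $S$ is identified with its group of inner automorphisms in $\mathrm{Aut}(S)$, and $\mathrm{PGL}(2,3^f)$ is identified with the subgroup of $\mathrm{Aut}(S)$ acting on $S$ by conjugation; the coset $\alpha S$ is taken in $\mathrm{Aut}(S)$. The Frobenius automorphism $\phi$ is the automorphism of $S$ induced by the field automorphism $a\mapsto a^3$ of the field with $3^f$ elements. A $2$-element is an element whose order is a power of $2$. *)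

theory Defs
  imports "HOL-Computational_Algebra.Polynomial" "HOL-Analysis.Determinants" "HOL-Algebra.Bij" "HOL-Number_Theory.Residues"
begin

section \<open>Linear groups over a field\<close>

definition GL :: "('a::field ^ 'n ^ 'n) monoid" where
  "GL = \<lparr>carrier = {A. invertible A}, mult = (**), one = mat 1\<rparr>"

definition SL :: "('a::field ^ 'n ^ 'n) monoid" where
  "SL = GL\<lparr>carrier := {A. det A = 1}\<rparr>"

definition scalars :: "('a::field ^ 'n ^ 'n) set" where
  "scalars = {mat c | c. c \<noteq> 0}"

definition PGL :: "('a::field ^ 'n ^ 'n) set monoid" where
  "PGL = GL Mod scalars"

definition PSL :: "('a::field ^ 'n ^ 'n) set monoid" where
  "PSL = SL Mod (scalars \<inter> carrier SL)"


section \<open>Automorphisms of the projective special linear group\<close>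

definition inner_aut :: "('g, 'b) monoid_scheme \<Rightarrow> 'g \<Rightarrow> 'g \<Rightarrow> 'g" where
  "inner_aut G a = (\<lambda>x\<in>carrier G. a \<otimes>\<^bsub>G\<^esub> x \<otimes>\<^bsub>G\<^esub> inv\<^bsub>G\<^esub> a)"

definition Inn :: "('g, 'b) monoid_scheme \<Rightarrow> ('g \<Rightarrow> 'g) set" where
  "Inn G = inner_aut G ` carrier G"

text \<open>
  A class \<open>C\<close> of matrices modulo scalars acts by conjugation on the classes \<open>X\<close> forming
  \<^const>\<open>PSL\<close>. Scalars cancel in \<open>A M A\<inverse>\<close>, so the set below is the coset of \<open>A M A\<inverse>\<close> for any
  representatives \<open>A\<close> of \<open>C\<close> and \<open>M\<close> of \<open>X\<close> (lemma \<open>PGL_conj_eq\<close>). The resulting map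
  from \<^const>\<open>PGL\<close> to the automorphism group is a homomorphism, injective for \<open>2 \<times> 2\<close> matrices,
  and extends the map sending an element of \<^const>\<open>PSL\<close> to its inner automorphism
  (lemmas \<open>PGL_conj_hom\<close>, \<open>PGL_conj_inj\<close>, \<open>inner_aut_PSL\<close>).
\<close>
definition PGL_conj :: "('a::field ^ 'n ^ 'n) set \<Rightarrow> ('a ^ 'n ^ 'n) set \<Rightarrow> ('a ^ 'n ^ 'n) set" where
  "PGL_conj C = (\<lambda>X\<in>carrier PSL. {A \<otimes>\<^bsub>GL\<^esub> M \<otimes>\<^bsub>GL\<^esub> inv\<^bsub>GL\<^esub> A | A M. A \<in> C \<and> M \<in> X})"

definition PGL_Aut :: "(('a::field ^ 'n ^ 'n) set \<Rightarrow> ('a ^ 'n ^ 'n) set) set" where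
  "PGL_Aut = PGL_conj ` carrier PGL"

definition PSL_field_aut ::
    "('a \<Rightarrow> 'a) \<Rightarrow> ('a::field ^ 'n ^ 'n) set \<Rightarrow> ('a ^ 'n ^ 'n) set" where
  "PSL_field_aut \<sigma> = (\<lambda>X\<in>carrier PSL. map_matrix \<sigma> ` X)"

definition p_element :: "nat \<Rightarrow> ('g, 'b) monoid_scheme \<Rightarrow> 'g \<Rightarrow> bool" where
  "p_element p G x \<longleftrightarrow> x \<in> carrier G \<and> (\<exists>m. group.ord G x = p ^ m)"


section \<open>Basic properties\<close>

lemma GL_simps [simp]:
  "carrier GL = {A. invertible A}" "A \<otimes>\<^bsub>GL\<^esub> B = A ** B" "\<one>\<^bsub>GL\<^esub> = mat 1"
  by (simp_all add: GL_def)

lemma group_GL: "group (GL :: ('a::field ^ 'n ^ 'n) monoid)"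
proof (rule groupI)
  fix A :: "'a ^ 'n ^ 'n"
  assume "A \<in> carrier GL"
  then obtain B where "A ** B = mat 1" "B ** A = mat 1"
    by (auto simp: invertible_def)
  then show "\<exists>B\<in>carrier GL. B \<otimes>\<^bsub>GL\<^esub> A = \<one>\<^bsub>GL\<^esub>"
    by (auto simp: invertible_def)
qed (auto simp: matrix_mul_assoc invertible_det_nz det_mul)

lemma GL_inv:
  fixes A :: "'a::field ^ 'n ^ 'n"
  assumes "invertible A"
  shows "invertible (inv\<^bsub>GL\<^esub> A)" "inv\<^bsub>GL\<^esub> A ** A = mat 1" "A ** inv\<^bsub>GL\<^esub> A = mat 1"
    "det A * det (inv\<^bsub>GL\<^esub> A) = 1"
proof -
  show "invertible (inv\<^bsub>GL\<^esub> A)" "inv\<^bsub>GL\<^esub> A ** A = mat 1" and *: "A ** inv\<^bsub>GL\<^esub> A = mat 1"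
    using group.l_inv[OF group_GL, of A] group.r_inv[OF group_GL, of A]
      group.inv_closed[OF group_GL, of A] assms by simp_all
  show "det A * det (inv\<^bsub>GL\<^esub> A) = 1"
    by (metis * det_I det_mul)
qed

lemma SL_simps [simp]:
  "carrier SL = {A. det A = 1}" "A \<otimes>\<^bsub>SL\<^esub> B = A ** B" "\<one>\<^bsub>SL\<^esub> = mat 1"
  by (simp_all add: SL_def)

lemma det_1_invertible: "det A = 1 \<Longrightarrow> invertible A" for A :: "'a::field ^ 'n ^ 'n"
  by (simp add: invertible_det_nz)

lemma det_conj:
  fixes A :: "'a::field ^ 'n ^ 'n"
  assumes "invertible A"
  shows "det (A ** M ** inv\<^bsub>GL\<^esub> A) = det M"
proof -
  have "det (A ** M ** inv\<^bsub>GL\<^esub> A) = det M * (det A * det (inv\<^bsub>GL\<^esub> A))"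
    by (simp add: det_mul)
  then show ?thesis
    by (simp add: GL_inv(4)[OF assms])
qed

lemma SL_normal: "carrier SL \<lhd> (GL :: ('a::field ^ 'n ^ 'n) monoid)"
proof -
  have "subgroup (carrier SL) (GL :: ('a ^ 'n ^ 'n) monoid)"
  proof (rule group.subgroupI[OF group_GL])
    fix A :: "'a ^ 'n ^ 'n"
    assume A: "A \<in> carrier SL"
    then show "inv\<^bsub>GL\<^esub> A \<in> carrier SL"
      using GL_inv(4)[OF det_1_invertible, of A] by simp
  next
    have "mat 1 \<in> carrier (SL :: ('a ^ 'n ^ 'n) monoid)" by simp
    then show "carrier (SL :: ('a ^ 'n ^ 'n) monoid) \<noteq> {}" by blast
  qed (simp_all add: det_mul subset_iff det_1_invertible)
  then show ?thesis
    by (simp add: group.normal_inv_iff[OF group_GL] det_conj)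
qed

lemma group_SL: "group (SL :: ('a::field ^ 'n ^ 'n) monoid)"
  unfolding SL_def using subgroup.subgroup_is_group[OF normal_imp_subgroup[OF SL_normal] group_GL]
  by simp

lemma mat_mult: "mat c ** A = (\<chi> i j. c * A $ i $ j)" for A :: "'a::field ^ 'n ^ 'n"
  by (simp add: matrix_matrix_mult_def mat_def vec_eq_iff if_distrib[of "\<lambda>x. x * _"] cong: if_cong)

lemma mult_mat: "A ** mat c = (\<chi> i j. c * A $ i $ j)" for A :: "'a::field ^ 'n ^ 'n"
  by (simp add: matrix_matrix_mult_def mat_def vec_eq_iff if_distrib[of "\<lambda>x. _ * x"] mult.commute cong: if_cong)

lemma mat_commute: "mat c ** A = A ** mat c" for A :: "'a::field ^ 'n ^ 'n"
  by (simp add: mat_mult mult_mat)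

lemma mat_times_mat: "mat c ** mat d = (mat (c * d) :: 'a::field ^ 'n ^ 'n)"
  by (simp add: mat_mult) (simp add: mat_def vec_eq_iff)

lemma invertible_mat: "c \<noteq> 0 \<Longrightarrow> invertible (mat c :: 'a::field ^ 'n ^ 'n)"
  unfolding invertible_def by (rule exI[of _ "mat (inverse c)"]) (simp add: mat_times_mat)

lemma GL_inv_mat: "c \<noteq> 0 \<Longrightarrow> inv\<^bsub>GL\<^esub> (mat c) = (mat (inverse c) :: 'a::field ^ 'n ^ 'n)"
  by (rule group.inv_equality[OF group_GL]) (simp_all add: mat_times_mat invertible_mat)

lemma conj_mat: "A ** mat c ** inv\<^bsub>GL\<^esub> A = mat c" if "invertible A" for A :: "'a::field ^ 'n ^ 'n"
proof -
  have "A ** mat c ** inv\<^bsub>GL\<^esub> A = mat c ** (A ** inv\<^bsub>GL\<^esub> A)"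
    by (simp add: mat_commute[symmetric] matrix_mul_assoc[symmetric])
  then show ?thesis
    by (simp add: GL_inv(3)[OF that])
qed

lemma scalars_normal: "scalars \<lhd> (GL :: ('a::field ^ 'n ^ 'n) monoid)"
proof -
  have "subgroup scalars (GL :: ('a ^ 'n ^ 'n) monoid)"
  proof (rule group.subgroupI[OF group_GL])
    show "scalars \<noteq> ({} :: ('a ^ 'n ^ 'n) set)"
      by (auto simp: scalars_def intro: exI[of _ 1])
    show "scalars \<subseteq> carrier (GL :: ('a ^ 'n ^ 'n) monoid)"
      by (auto simp: scalars_def invertible_mat)
  next
    fix A :: "'a ^ 'n ^ 'n"
    assume "A \<in> scalars"
    then show "inv\<^bsub>GL\<^esub> A \<in> scalars"
      by (auto simp: scalars_def GL_inv_mat)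
  next
    fix A B :: "'a ^ 'n ^ 'n"
    assume "A \<in> scalars" "B \<in> scalars"
    then show "A \<otimes>\<^bsub>GL\<^esub> B \<in> scalars"
      by (force simp: scalars_def mat_times_mat)
  qed
  moreover have "A ** Z ** inv\<^bsub>GL\<^esub> A \<in> scalars"
    if "invertible A" "Z \<in> scalars" for A Z :: "'a ^ 'n ^ 'n"
    using that by (auto simp: scalars_def conj_mat)
  ultimately show ?thesis
    by (simp add: group.normal_inv_iff[OF group_GL])
qed

lemma SL_scalars_normal: "scalars \<inter> carrier SL \<lhd> (SL :: ('a::field ^ 'n ^ 'n) monoid)"
  using group.normal_Int_subgroup[OF group_GL normal_imp_subgroup[OF SL_normal] scalars_normal]
  by (simp add: SL_def Int_commute)

lemma group_PGL: "group (PGL :: ('a::field ^ 'n ^ 'n) set monoid)"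
  unfolding PGL_def by (rule normal.factorgroup_is_group[OF scalars_normal])

lemma group_PSL: "group (PSL :: ('a::field ^ 'n ^ 'n) set monoid)"
  unfolding PSL_def by (rule normal.factorgroup_is_group[OF SL_scalars_normal])

declare SL_simps(1) [simp del]

lemma carrier_PSL: "carrier PSL = {scalars \<inter> carrier SL #>\<^bsub>SL\<^esub> M | M. det M = 1}"
  by (auto simp: PSL_def carrier_FactGroup SL_simps(1))

lemma coset_in_PSL: "det M = 1 \<Longrightarrow> scalars \<inter> carrier SL #>\<^bsub>SL\<^esub> M \<in> carrier PSL"
  by (auto simp: carrier_PSL)

lemma carrier_PGL: "carrier PGL = {scalars #>\<^bsub>GL\<^esub> A | A. invertible A}"
  by (auto simp: PGL_def carrier_FactGroup)

lemma PSL_mult: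
  fixes M N :: "'a::field ^ 'n ^ 'n"
  assumes "det M = 1" "det N = 1"
  shows "(scalars \<inter> carrier SL #>\<^bsub>SL\<^esub> M) \<otimes>\<^bsub>PSL\<^esub> (scalars \<inter> carrier SL #>\<^bsub>SL\<^esub> N)
    = scalars \<inter> carrier SL #>\<^bsub>SL\<^esub> (M ** N)"
  using normal.rcos_sum[OF SL_scalars_normal, of M N] assms by (simp add: PSL_def SL_simps(1))

lemma PGL_mult:
  fixes A B :: "'a::field ^ 'n ^ 'n"
  assumes "invertible A" "invertible B"
  shows "(scalars #>\<^bsub>GL\<^esub> A) \<otimes>\<^bsub>PGL\<^esub> (scalars #>\<^bsub>GL\<^esub> B) = scalars #>\<^bsub>GL\<^esub> (A ** B)"
  using normal.rcos_sum[OF scalars_normal, of A B] assms by (simp add: PGL_def)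

lemma PSL_coset:
  "scalars \<inter> carrier SL #>\<^bsub>SL\<^esub> M = {mat c ** M | c. c \<noteq> 0 \<and> det (mat c :: 'a ^ 'n ^ 'n) = 1}"
  for M :: "'a::field ^ 'n ^ 'n"
  by (auto simp: r_coset_def scalars_def SL_simps(1))

lemma PGL_coset: "scalars #>\<^bsub>GL\<^esub> A = {mat c ** A | c. c \<noteq> 0}"
  for A :: "'a::field ^ 'n ^ 'n"
  by (auto simp: r_coset_def scalars_def)

lemma GL_inv_scalar_mult:
  fixes A :: "'a::field ^ 'n ^ 'n"
  assumes "c \<noteq> 0" "invertible A"
  shows "inv\<^bsub>GL\<^esub> (mat c ** A) = inv\<^bsub>GL\<^esub> A ** mat (inverse c)"
  using group.inv_mult_group[OF group_GL, of "mat c" A] assms by (simp add: invertible_mat GL_inv_mat)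

lemma conj_scalar_mult:
  fixes A :: "'a::field ^ 'n ^ 'n"
  assumes "c \<noteq> 0" "invertible A"
  shows "mat c ** A ** M ** inv\<^bsub>GL\<^esub> (mat c ** A) = A ** M ** inv\<^bsub>GL\<^esub> A"
proof -
  have "mat c ** A ** M ** inv\<^bsub>GL\<^esub> (mat c ** A)
      = mat c ** (A ** M ** inv\<^bsub>GL\<^esub> A) ** mat (inverse c)"
    by (simp add: GL_inv_scalar_mult[OF assms] matrix_mul_assoc)
  also have "\<dots> = mat c ** mat (inverse c) ** (A ** M ** inv\<^bsub>GL\<^esub> A)"
    by (simp add: mat_commute[of "inverse c"] matrix_mul_assoc[symmetric])
  finally show ?thesis
    using assms(1) by (simp add: mat_times_mat)
qed

lemma PGL_conj_eq:
  fixes A :: "'a::field ^ 'n ^ 'n"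
  assumes "invertible A" "det M = 1"
  shows "PGL_conj (scalars #>\<^bsub>GL\<^esub> A) (scalars \<inter> carrier SL #>\<^bsub>SL\<^esub> M)
    = scalars \<inter> carrier SL #>\<^bsub>SL\<^esub> (A ** M ** inv\<^bsub>GL\<^esub> A)" (is "?L = ?R")
proof -
  have *: "A ** (mat d ** M) ** inv\<^bsub>GL\<^esub> A = mat d ** (A ** M ** inv\<^bsub>GL\<^esub> A)" for d
    by (simp add: matrix_mul_assoc mat_commute[of d A])
  have "scalars \<inter> carrier SL #>\<^bsub>SL\<^esub> M \<in> carrier PSL"
    using assms(2) by (auto simp: carrier_PSL)
  then have "?L = {B ** N ** inv\<^bsub>GL\<^esub> B | B N.
      B \<in> scalars #>\<^bsub>GL\<^esub> A \<and> N \<in> scalars \<inter> carrier SL #>\<^bsub>SL\<^esub> M}"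
    by (simp add: PGL_conj_def)
  also have "\<dots> = {A ** N ** inv\<^bsub>GL\<^esub> A | N. N \<in> scalars \<inter> carrier SL #>\<^bsub>SL\<^esub> M}"
  proof -
    have "A \<in> scalars #>\<^bsub>GL\<^esub> A"
      using group.rcos_self[OF group_GL, of A] normal_imp_subgroup[OF scalars_normal] assms(1) by simp
    moreover have "B ** N ** inv\<^bsub>GL\<^esub> B = A ** N ** inv\<^bsub>GL\<^esub> A" if "B \<in> scalars #>\<^bsub>GL\<^esub> A" for B N
      using that conj_scalar_mult[OF _ assms(1)] unfolding PGL_coset by force
    ultimately show ?thesis
      by blast
  qed
  also have "\<dots> = ?R"
    unfolding PSL_coset *[symmetric] by blast
  finally show ?thesis .
qed

lemma PGL_conj_mult:
  fixes C D :: "('a::field ^ 'n ^ 'n) set"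
  assumes "C \<in> carrier PGL" "D \<in> carrier PGL" "X \<in> carrier PSL"
  shows "PGL_conj (C \<otimes>\<^bsub>PGL\<^esub> D) X = PGL_conj C (PGL_conj D X)"
proof -
  obtain A B M where [simp]: "C = scalars #>\<^bsub>GL\<^esub> A" "D = scalars #>\<^bsub>GL\<^esub> B"
      "X = scalars \<inter> carrier SL #>\<^bsub>SL\<^esub> M"
    and *: "invertible A" "invertible B" "det M = 1"
    using assms by (auto simp: carrier_PGL carrier_PSL)
  have "inv\<^bsub>GL\<^esub> (A ** B) = inv\<^bsub>GL\<^esub> B ** inv\<^bsub>GL\<^esub> A"
    using group.inv_mult_group[OF group_GL, of A B] * by simp
  then show ?thesis
    using * by (simp add: PGL_mult PGL_conj_eq det_conj invertible_mult matrix_mul_assoc)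
qed

lemma PGL_conj_closed: "PGL_conj C X \<in> carrier PSL" if "C \<in> carrier PGL" "X \<in> carrier PSL"
  for C :: "('a::field ^ 'n ^ 'n) set"
proof -
  from that obtain A M where "C = scalars #>\<^bsub>GL\<^esub> A" "invertible A"
      "X = scalars \<inter> carrier SL #>\<^bsub>SL\<^esub> M" "det M = 1"
    by (auto simp: carrier_PGL carrier_PSL)
  then show ?thesis
    by (simp add: PGL_conj_eq det_conj coset_in_PSL)
qed

lemma PGL_conj_one: "PGL_conj \<one>\<^bsub>PGL\<^esub> X = X" if "X \<in> carrier PSL"
  for X :: "('a::field ^ 'n ^ 'n) set"
proof -
  have 1: "\<one>\<^bsub>PGL\<^esub> = scalars #>\<^bsub>GL\<^esub> (mat 1 :: 'a ^ 'n ^ 'n)"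
    by (simp add: PGL_def PGL_coset) (simp add: scalars_def)
  have 2: "inv\<^bsub>GL\<^esub> (mat 1 :: 'a ^ 'n ^ 'n) = mat 1"
    using GL_inv_mat[of 1] by simp
  have 3: "invertible (mat 1 :: 'a ^ 'n ^ 'n)"
    by (simp add: invertible_mat)
  from that obtain M where M: "X = scalars \<inter> carrier SL #>\<^bsub>SL\<^esub> M" "det M = 1"
    by (auto simp: carrier_PSL)
  then show ?thesis
    using PGL_conj_eq[OF 3 M(2)] by (simp add: 1 2)
qed

lemma PGL_conj_auto:
  fixes C :: "('a::field ^ 'n ^ 'n) set"
  assumes C: "C \<in> carrier PGL"
  shows "PGL_conj C \<in> auto PSL"
proof -
  interpret P: group "PGL :: ('a ^ 'n ^ 'n) set monoid" by (rule group_PGL)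
  have "bij_betw (PGL_conj C) (carrier PSL) (carrier PSL)"
    using C PGL_conj_mult[OF P.inv_closed[OF C] C] PGL_conj_mult[OF C P.inv_closed[OF C]]
    by (intro bij_betw_byWitness[where f' = "PGL_conj (inv\<^bsub>PGL\<^esub> C)"])
      (auto simp: PGL_conj_one PGL_conj_closed)
  moreover have "PGL_conj C (X \<otimes>\<^bsub>PSL\<^esub> Y) = PGL_conj C X \<otimes>\<^bsub>PSL\<^esub> PGL_conj C Y"
    if XY: "X \<in> carrier PSL" "Y \<in> carrier PSL" for X Y
  proof -
    obtain A M N where [simp]: "C = scalars #>\<^bsub>GL\<^esub> A" "X = scalars \<inter> carrier SL #>\<^bsub>SL\<^esub> M"
        "Y = scalars \<inter> carrier SL #>\<^bsub>SL\<^esub> N"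
      and *: "invertible A" "det M = 1" "det N = 1"
      using C XY by (auto simp: carrier_PGL carrier_PSL)
    have "A ** M ** inv\<^bsub>GL\<^esub> A ** (A ** N ** inv\<^bsub>GL\<^esub> A)
        = A ** M ** (inv\<^bsub>GL\<^esub> A ** A) ** N ** inv\<^bsub>GL\<^esub> A"
      by (simp add: matrix_mul_assoc)
    then have "A ** M ** inv\<^bsub>GL\<^esub> A ** (A ** N ** inv\<^bsub>GL\<^esub> A) = A ** (M ** N) ** inv\<^bsub>GL\<^esub> A"
      by (simp add: GL_inv(2)[OF *(1)] matrix_mul_assoc)
    moreover have "det (M ** N) = 1"
      using * by (simp add: det_mul)
    ultimately show ?thesis
      using * by (simp add: PSL_mult PGL_conj_eq det_conj)
  qed
  ultimately show ?thesis
    using C by (auto simp: auto_def hom_def Bij_def PGL_conj_closed) (simp add: PGL_conj_def)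
qed

lemma AutoGroup_simps:
  "carrier (AutoGroup G) = auto G"
  "\<lbrakk>a \<in> auto G; b \<in> auto G\<rbrakk> \<Longrightarrow> a \<otimes>\<^bsub>AutoGroup G\<^esub> b = compose (carrier G) a b"
  "\<one>\<^bsub>AutoGroup G\<^esub> = (\<lambda>x\<in>carrier G. x)"
  by (auto simp: AutoGroup_def BijGroup_def auto_def)

lemma PGL_conj_hom: "PGL_conj \<in> hom PGL (AutoGroup (PSL :: ('a::field ^ 'n ^ 'n) set monoid))"
proof (rule homI)
  fix C D :: "('a ^ 'n ^ 'n) set"
  assume CD: "C \<in> carrier PGL" "D \<in> carrier PGL"
  then have "C \<otimes>\<^bsub>PGL\<^esub> D \<in> carrier PGL"
    by (rule monoid.m_closed[OF group.is_monoid[OF group_PGL]])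
  have "PGL_conj (C \<otimes>\<^bsub>PGL\<^esub> D) = compose (carrier PSL) (PGL_conj C) (PGL_conj D)"
  proof (intro ext)
    fix X :: "('a ^ 'n ^ 'n) set"
    show "PGL_conj (C \<otimes>\<^bsub>PGL\<^esub> D) X = compose (carrier PSL) (PGL_conj C) (PGL_conj D) X"
    proof (cases "X \<in> carrier PSL")
      case True
      then show ?thesis
        using CD by (simp add: compose_def PGL_conj_mult)
    next
      case False
      then show ?thesis
        by (simp add: compose_def PGL_conj_def)
    qed
  qed
  then show "PGL_conj (C \<otimes>\<^bsub>PGL\<^esub> D) = PGL_conj C \<otimes>\<^bsub>AutoGroup PSL\<^esub> PGL_conj D"
    using CD by (simp add: AutoGroup_simps PGL_conj_auto)
qed (simp add: AutoGroup_simps PGL_conj_auto)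


lemma PSL_field_aut_eq:
  fixes M N :: "'a::field ^ 'n ^ 'n"
  assumes \<sigma>: "bij \<sigma>" "\<sigma> 0 = 0" "\<sigma> 1 = 1"
    and add: "\<And>x y. \<sigma> (x + y) = \<sigma> x + \<sigma> y" and mult: "\<And>x y. \<sigma> (x * y) = \<sigma> x * \<sigma> y"
    and M: "det M = 1"
  shows "map_matrix \<sigma> (M ** N) = map_matrix \<sigma> M ** map_matrix \<sigma> N"
    and "det (map_matrix \<sigma> M) = 1"
    and "PSL_field_aut \<sigma> (scalars \<inter> carrier SL #>\<^bsub>SL\<^esub> M) = scalars \<inter> carrier SL #>\<^bsub>SL\<^esub> map_matrix \<sigma> M"
proof -
  have sum: "\<sigma> (sum f A) = (\<Sum>i\<in>A. \<sigma> (f i))" for f :: "'i \<Rightarrow> 'a" and A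
    by (induction A rule: infinite_finite_induct) (simp_all add: assms)
  have prod: "\<sigma> (prod f A) = (\<Prod>i\<in>A. \<sigma> (f i))" for f :: "'i \<Rightarrow> 'a" and A
    by (induction A rule: infinite_finite_induct) (simp_all add: assms)
  have neg: "\<sigma> (- x) = - \<sigma> x" for x
    using add[of x "- x"] \<sigma>(2) by (simp add: eq_neg_iff_add_eq_0 add.commute)
  have sgn: "\<sigma> (of_int (sign p)) = of_int (sign p)" for p :: "'n \<Rightarrow> 'n"
    by (simp add: sign_def neg \<sigma>)
  have det: "det (map_matrix \<sigma> A) = \<sigma> (det A)" for A :: "'a ^ 'n ^ 'n"
    by (simp add: det_def sum prod mult sgn)
  have mm: "map_matrix \<sigma> (A ** B) = map_matrix \<sigma> A ** map_matrix \<sigma> B" for A B :: "'a ^ 'n ^ 'n"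
    by (simp add: vec_eq_iff matrix_matrix_mult_def sum mult)
  show "map_matrix \<sigma> (M ** N) = map_matrix \<sigma> M ** map_matrix \<sigma> N"
    by (rule mm)
  show "det (map_matrix \<sigma> M) = 1"
    using M \<sigma>(3) by (simp add: det)
  have mat: "map_matrix \<sigma> (mat c :: 'a ^ 'n ^ 'n) = mat (\<sigma> c)" for c
    using \<sigma>(2) by (simp add: vec_eq_iff mat_def)
  have inj: "\<sigma> x = \<sigma> y \<longleftrightarrow> x = y" for x y
    using \<sigma>(1) by (auto simp: bij_def inj_def)
  have surj: "\<exists>x. y = \<sigma> x" for y
    using \<sigma>(1) by (meson bij_pointE)
  have iff: "\<sigma> c \<noteq> 0 \<and> det (mat (\<sigma> c) :: 'a ^ 'n ^ 'n) = 1 \<longleftrightarrow> c \<noteq> 0 \<and> det (mat c :: 'a ^ 'n ^ 'n) = 1" for c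
    using inj[of c 0] inj[of "det (mat c :: 'a ^ 'n ^ 'n)" 1] \<sigma> by (simp add: det flip: mat)
  have "map_matrix \<sigma> ` (scalars \<inter> carrier SL #>\<^bsub>SL\<^esub> M)
      = {map_matrix \<sigma> (mat c ** M) | c. c \<noteq> 0 \<and> det (mat c :: 'a ^ 'n ^ 'n) = 1}"
    unfolding PSL_coset by blast
  also have "\<dots> = {mat (\<sigma> c) ** map_matrix \<sigma> M | c. \<sigma> c \<noteq> 0 \<and> det (mat (\<sigma> c) :: 'a ^ 'n ^ 'n) = 1}"
    by (simp only: mm mat iff)
  also have "\<dots> = scalars \<inter> carrier SL #>\<^bsub>SL\<^esub> map_matrix \<sigma> M"
    unfolding PSL_coset by (intro Collect_cong) (metis surj)
  finally show "PSL_field_aut \<sigma> (scalars \<inter> carrier SL #>\<^bsub>SL\<^esub> M)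
      = scalars \<inter> carrier SL #>\<^bsub>SL\<^esub> map_matrix \<sigma> M"
    by (simp add: PSL_field_aut_def coset_in_PSL M)
qed

lemma map_matrix_map_matrix: "map_matrix f (map_matrix g M) = map_matrix (f \<circ> g) M"
  by (simp add: vec_eq_iff)

lemma map_matrix_id: "map_matrix (\<lambda>x. x) M = M"
  by (simp add: vec_eq_iff)

lemma PSL_field_aut_compose:
  "PSL_field_aut (\<sigma> \<circ> \<tau>) X = map_matrix \<sigma> ` PSL_field_aut \<tau> X"
  if "X \<in> carrier PSL" for X :: "('a::field ^ 'n ^ 'n) set"
  using that by (simp add: PSL_field_aut_def image_image map_matrix_map_matrix)

lemma PSL_field_aut_auto:
  fixes \<sigma> :: "'a::field \<Rightarrow> 'a"
  assumes \<sigma>: "bij \<sigma>" "\<sigma> 0 = 0" "\<sigma> 1 = 1"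
    and hom: "\<And>x y. \<sigma> (x + y) = \<sigma> x + \<sigma> y" "\<And>x y. \<sigma> (x * y) = \<sigma> x * \<sigma> y"
  shows "PSL_field_aut \<sigma> \<in> auto (PSL :: ('a ^ 'n ^ 'n) set monoid)"
proof -
  define \<tau> where "\<tau> = inv_into UNIV \<sigma>"
  have \<sigma>\<tau>: "\<sigma> (\<tau> x) = x" and \<tau>\<sigma>: "\<tau> (\<sigma> x) = x" for x
    using \<sigma>(1) by (simp_all add: \<tau>_def bij_is_surj surj_f_inv_f bij_is_inj inv_f_f)
  have \<tau>: "bij \<tau>" "\<tau> 0 = 0" "\<tau> 1 = 1"
    using \<sigma> \<tau>\<sigma>[of 0] \<tau>\<sigma>[of 1] by (simp_all add: \<tau>_def bij_imp_bij_inv)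
  have "\<tau> (x + y) = \<tau> x + \<tau> y" "\<tau> (x * y) = \<tau> x * \<tau> y" for x y
    using \<tau>\<sigma>[of "\<tau> x + \<tau> y"] \<tau>\<sigma>[of "\<tau> x * \<tau> y"] by (simp_all add: hom \<sigma>\<tau>)
  note \<sigma>_eq = PSL_field_aut_eq[OF \<sigma> hom] and \<tau>_eq = PSL_field_aut_eq[OF \<tau> this]
  have closed: "PSL_field_aut \<sigma> X \<in> carrier PSL" "PSL_field_aut \<tau> X \<in> carrier PSL"
      "PSL_field_aut \<tau> (PSL_field_aut \<sigma> X) = X" "PSL_field_aut \<sigma> (PSL_field_aut \<tau> X) = X"
    if "X \<in> carrier PSL" for X :: "('a ^ 'n ^ 'n) set"
  proof -
    from that obtain M where "X = scalars \<inter> carrier SL #>\<^bsub>SL\<^esub> M" "det M = 1"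
      by (auto simp: carrier_PSL)
    then show "PSL_field_aut \<sigma> X \<in> carrier PSL" "PSL_field_aut \<tau> X \<in> carrier PSL"
        "PSL_field_aut \<tau> (PSL_field_aut \<sigma> X) = X" "PSL_field_aut \<sigma> (PSL_field_aut \<tau> X) = X"
      by (simp_all add: \<sigma>_eq(2,3) \<tau>_eq(2,3) coset_in_PSL map_matrix_map_matrix comp_def \<sigma>\<tau> \<tau>\<sigma> map_matrix_id)
  qed
  have "bij_betw (PSL_field_aut \<sigma>) (carrier PSL) (carrier (PSL :: ('a ^ 'n ^ 'n) set monoid))"
    by (rule bij_betw_byWitness[where f' = "PSL_field_aut \<tau>"]) (auto simp: closed)
  moreover have "PSL_field_aut \<sigma> (X \<otimes>\<^bsub>PSL\<^esub> Y) = PSL_field_aut \<sigma> X \<otimes>\<^bsub>PSL\<^esub> PSL_field_aut \<sigma> Y"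
    if "X \<in> carrier PSL" "Y \<in> carrier PSL" for X Y :: "('a ^ 'n ^ 'n) set"
  proof -
    from that obtain M N where "X = scalars \<inter> carrier SL #>\<^bsub>SL\<^esub> M" "det M = 1"
        "Y = scalars \<inter> carrier SL #>\<^bsub>SL\<^esub> N" "det N = 1"
      by (auto simp: carrier_PSL)
    then show ?thesis
      using det_mul[of M N] by (simp add: PSL_mult \<sigma>_eq)
  qed
  moreover have "PSL_field_aut \<sigma> \<in> extensional (carrier (PSL :: ('a ^ 'n ^ 'n) set monoid))"
    by (simp add: PSL_field_aut_def)
  ultimately show ?thesis
    by (auto simp: auto_def hom_def Bij_def closed(1))
qed

context
  fixes f :: nat and \<phi> :: "('a::finite_field ^ 2 ^ 2) set \<Rightarrow> ('a ^ 2 ^ 2) set"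
  assumes f: "f > 0" and card: "CARD('a) = 3 ^ f"
  defines "\<phi> \<equiv> PSL_field_aut (\<lambda>a. a ^ 3)"
begin

lemma CHAR_3: "CHAR('a) = 3"
proof -
  have "prime CHAR('a)"
    using finite_imp_CHAR_pos[where ?'a = 'a] by (intro prime_CHAR_semidom) simp
  moreover have "CHAR('a) dvd 3 ^ f"
    using CHAR_dvd_CARD[where ?'a = 'a] card by simp
  moreover have "prime (3 :: nat)"
    by simp
  ultimately show ?thesis
    by (metis prime_dvd_power primes_dvd_imp_eq)
qed

lemma power_3_hom:
  "bij (\<lambda>a :: 'a. a ^ 3 ^ k)" "(0 :: 'a) ^ 3 ^ k = 0" "(1 :: 'a) ^ 3 ^ k = 1"
  "(x + y :: 'a) ^ 3 ^ k = x ^ 3 ^ k + y ^ 3 ^ k" "(x * y) ^ 3 ^ k = x ^ 3 ^ k * y ^ 3 ^ k"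
proof -
  show add: "(x + y :: 'a) ^ 3 ^ k = x ^ 3 ^ k + y ^ 3 ^ k" for x y
    by (rule freshmans_dream') (simp_all add: CHAR_3)
  have "inj (\<lambda>a :: 'a. a ^ 3 ^ k)"
  proof (rule injI)
    fix x y :: 'a
    assume "x ^ 3 ^ k = y ^ 3 ^ k"
    then have "(x - y) ^ 3 ^ k = 0"
      using add[of "x - y" y] by simp
    then show "x = y" by simp
  qed
  then show "bij (\<lambda>a :: 'a. a ^ 3 ^ k)"
    by (simp add: bij_def finite_UNIV_inj_surj)
qed (simp_all add: power_mult_distrib)

lemma Frobenius_auto: "\<phi> \<in> auto PSL"
  unfolding \<phi>_def by (rule PSL_field_aut_auto) (use power_3_hom[where k = 1] in simp_all)

lemma Frobenius_power: "\<phi> [^]\<^bsub>AutoGroup PSL\<^esub> k = PSL_field_aut (\<lambda>a. a ^ 3 ^ k)"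
proof (induction k)
  case 0
  show ?case
    by (simp add: AutoGroup_simps PSL_field_aut_def map_matrix_id nat_pow_def cong: restrict_cong)
next
  case (Suc k)
  have "PSL_field_aut (\<lambda>a. a ^ 3 ^ k) \<in> auto (PSL :: ('a ^ 2 ^ 2) set monoid)"
    by (rule PSL_field_aut_auto) (use power_3_hom[where k = k] in simp_all)
  moreover have "\<phi> X \<in> carrier PSL" if "X \<in> carrier PSL" for X
    using Frobenius_auto that by (auto simp: auto_def hom_def)
  ultimately show ?case
    by (simp add: Suc AutoGroup_simps Frobenius_auto)
      (auto simp: compose_def PSL_field_aut_def \<phi>_def image_image map_matrix_map_matrix
        comp_def fun_eq_iff simp flip: power_mult)
qed

lemma Frobenius_ord: "group.ord (AutoGroup PSL) \<phi> = f"
proof -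
  interpret A: group "AutoGroup (PSL :: ('a ^ 2 ^ 2) set monoid)"
    by (rule group.AutoGroup[OF group_PSL])
  have \<phi>: "\<phi> \<in> carrier (AutoGroup PSL)"
    by (simp add: AutoGroup_simps Frobenius_auto)
  have "x ^ 3 ^ f = x" for x :: 'a
    using finite_field_power_card_eq_same[of x] by (simp add: card)
  then have "\<phi> [^]\<^bsub>AutoGroup PSL\<^esub> f = \<one>\<^bsub>AutoGroup PSL\<^esub>"
    by (simp add: Frobenius_power AutoGroup_simps PSL_field_aut_def map_matrix_id cong: restrict_cong)
  then have dvd: "A.ord \<phi> dvd f"
    using A.pow_eq_id[OF \<phi>] by blast
  define k where "k = A.ord \<phi>"
  have "\<phi> [^]\<^bsub>AutoGroup PSL\<^esub> k = \<one>\<^bsub>AutoGroup PSL\<^esub>"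
    using A.pow_eq_id[OF \<phi>] by (simp add: k_def)
  then have *: "PSL_field_aut (\<lambda>a. a ^ 3 ^ k) X = X" if "X \<in> carrier PSL" for X :: "('a ^ 2 ^ 2) set"
    using that by (simp add: Frobenius_power AutoGroup_simps)
  have fixed: "a ^ 3 ^ k = a" for a :: 'a
  proof -
    define M :: "'a ^ 2 ^ 2" where "M = vector [vector [1, a], vector [0, 1]]"
    have M: "det M = 1"
      by (simp add: M_def det_2)
    have "map_matrix (\<lambda>a. a ^ 3 ^ k) M \<in> PSL_field_aut (\<lambda>a. a ^ 3 ^ k) (scalars \<inter> carrier SL #>\<^bsub>SL\<^esub> M)"
      using coset_in_PSL[OF M] group.rcos_self[OF group_SL _ normal_imp_subgroup[OF SL_scalars_normal], of M] M
      by (simp add: PSL_field_aut_def SL_simps(1))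
    then have "map_matrix (\<lambda>a. a ^ 3 ^ k) M \<in> scalars \<inter> carrier SL #>\<^bsub>SL\<^esub> M"
      using *[OF coset_in_PSL[OF M]] by simp
    then obtain c where "map_matrix (\<lambda>a. a ^ 3 ^ k) M = mat c ** M"
      by (auto simp: PSL_coset)
    then have "(M $ i $ j) ^ 3 ^ k = c * M $ i $ j" for i j
      by (simp add: mat_mult vec_eq_iff)
    from this[of 1 1] this[of 1 2] show ?thesis
      by (simp add: M_def)
  qed
  have "k > 0"
    using dvd f by (auto simp: k_def intro: gr0I)
  then have k1: "(1::nat) < 3 ^ k"
    by (intro one_less_power) simp_all
  define p :: "'a poly" where "p = Polynomial.monom 1 (3 ^ k) - Polynomial.monom 1 1"
  have deg: "Polynomial.degree p \<le> 3 ^ k"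
    unfolding p_def using k1 by (intro degree_diff_le) (simp_all add: Polynomial.degree_monom_eq)
  have "Polynomial.coeff p (3 ^ k) = 1"
    using k1 by (simp add: p_def)
  then have "p \<noteq> 0" by auto
  then have "card {x. poly p x = 0} \<le> 3 ^ k"
    using card_poly_roots_bound[of p] deg by linarith
  also have "{x. poly p x = 0} = UNIV"
    by (simp add: p_def poly_monom fixed)
  finally have "f \<le> k"
    by (simp add: card)
  with dvd f show ?thesis
    by (simp add: k_def dvd_imp_le le_antisym)
qed

end

lemma PGL_conj_inj: "inj_on PGL_conj (carrier PGL :: ('a::field ^ 2 ^ 2) set set)"
proof -
  interpret P: group "PGL :: ('a ^ 2 ^ 2) set monoid" by (rule group_PGL)
  interpret A: group "AutoGroup (PSL :: ('a ^ 2 ^ 2) set monoid)"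
    by (rule group.AutoGroup[OF group_PSL])
  interpret group_hom "PGL :: ('a ^ 2 ^ 2) set monoid" "AutoGroup PSL" PGL_conj
    by unfold_locales (rule PGL_conj_hom)
  show ?thesis
  unfolding inj_on_one_iff
  proof (intro allI impI)
    fix C :: "('a ^ 2 ^ 2) set"
    assume "C \<in> carrier PGL" and C1: "PGL_conj C = \<one>\<^bsub>AutoGroup PSL\<^esub>"
    then obtain A where C: "C = scalars #>\<^bsub>GL\<^esub> A" and A: "invertible A"
      by (auto simp: carrier_PGL)
    have conj: "\<exists>c. A ** M = mat c ** M ** A" if M: "det M = 1" for M
    proof -
      have "A ** M ** inv\<^bsub>GL\<^esub> A \<in> scalars \<inter> carrier SL #>\<^bsub>SL\<^esub> (A ** M ** inv\<^bsub>GL\<^esub> A)"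
        using group.rcos_self[OF group_SL _ normal_imp_subgroup[OF SL_scalars_normal], of "A ** M ** inv\<^bsub>GL\<^esub> A"]
        by (simp add: SL_simps(1) det_conj A M)
      also have "\<dots> = scalars \<inter> carrier SL #>\<^bsub>SL\<^esub> M"
        using C1 coset_in_PSL[OF M] unfolding C
        by (simp add: AutoGroup_simps flip: PGL_conj_eq[OF A M])
      finally obtain c where "A ** M ** inv\<^bsub>GL\<^esub> A = mat c ** M"
        by (auto simp: PSL_coset)
      then have "A ** M ** (inv\<^bsub>GL\<^esub> A ** A) = mat c ** M ** A"
        by (simp add: matrix_mul_assoc)
      then show ?thesis
        by (auto simp: GL_inv(2)[OF A])
    qed
    define U :: "'a ^ 2 ^ 2" where "U = vector [vector [1, 1], vector [0, 1]]"
    define L :: "'a ^ 2 ^ 2" where "L = vector [vector [1, 0], vector [1, 1]]"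
    have "det U = 1" "det L = 1"
      by (simp_all add: U_def L_def det_2)
    then obtain c d where cd: "A ** U = mat c ** U ** A" "A ** L = mat d ** L ** A"
      using conj by blast
    have "(A ** U) $ i $ j = c * (U ** A) $ i $ j" "(A ** L) $ i $ j = d * (L ** A) $ i $ j" for i j
      by (simp_all add: cd matrix_mul_assoc[symmetric]) (simp_all add: mat_mult)
    from this(1)[of 1 1] this(1)[of 1 2] this(1)[of 2 1] this(1)[of 2 2]
      this(2)[of 1 1] this(2)[of 1 2] this(2)[of 2 1] this(2)[of 2 2]
    have eqs: "A$1$1 = c * (A$1$1 + A$2$1)" "A$1$1 + A$1$2 = c * (A$1$2 + A$2$2)" "A$2$1 = c * A$2$1"
      "A$2$1 + A$2$2 = c * A$2$2"
      "A$1$1 + A$1$2 = d * A$1$1" "A$1$2 = d * A$1$2" "A$2$1 + A$2$2 = d * (A$1$1 + A$2$1)" "A$2$2 = d * (A$1$2 + A$2$2)"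
      by (simp_all add: matrix_matrix_mult_def sum_2 U_def L_def)
    have nz: "A$1$1 * A$2$2 - A$1$2 * A$2$1 \<noteq> 0"
      using A by (simp add: invertible_det_nz det_2)
    have z: "A$2$1 = 0" "A$1$2 = 0"
      using eqs by (auto simp: algebra_simps) 
    have "A$1$1 = A$2$2"
      using eqs z nz by auto
    then have "A = mat (A$1$1)" "A$1$1 \<noteq> 0"
      using z nz by (auto simp: vec_eq_iff mat_def forall_2)
    then have "A \<in> scalars"
      by (auto simp: scalars_def)
    then show "C = \<one>\<^bsub>PGL\<^esub>"
      using group.coset_join2[OF group_GL _ normal_imp_subgroup[OF scalars_normal], of A] A
      by (simp add: C PGL_def)
  qed
qed

lemma inner_aut_PSL:
  fixes M :: "'a::field ^ 'n ^ 'n"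
  assumes M: "det M = 1"
  shows "inner_aut PSL (scalars \<inter> carrier SL #>\<^bsub>SL\<^esub> M) = PGL_conj (scalars #>\<^bsub>GL\<^esub> M)"
proof -
  note A = det_1_invertible[OF M]
  have M': "det (inv\<^bsub>GL\<^esub> M) = 1"
    using GL_inv(4)[OF A] M by simp
  have "inv\<^bsub>PSL\<^esub> (scalars \<inter> carrier SL #>\<^bsub>SL\<^esub> M) = scalars \<inter> carrier SL #>\<^bsub>SL\<^esub> inv\<^bsub>GL\<^esub> M"
  proof (rule group.inv_equality[OF group_PSL])
    have "scalars \<inter> carrier SL #>\<^bsub>SL\<^esub> (mat 1 :: 'a ^ 'n ^ 'n) = scalars \<inter> carrier SL"
      using subgroup.one_closed[OF normal_imp_subgroup[OF SL_scalars_normal]]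
      by (intro group.coset_join2[OF group_SL _ normal_imp_subgroup[OF SL_scalars_normal]])
        (simp_all add: SL_simps(1))
    then show "(scalars \<inter> carrier SL #>\<^bsub>SL\<^esub> inv\<^bsub>GL\<^esub> M) \<otimes>\<^bsub>PSL\<^esub> (scalars \<inter> carrier SL #>\<^bsub>SL\<^esub> M) = \<one>\<^bsub>PSL\<^esub>"
      by (simp add: PSL_mult M M' GL_inv(2)[OF A]) (simp add: PSL_def)
  qed (simp_all add: coset_in_PSL M M')
  moreover have "PGL_conj (scalars #>\<^bsub>GL\<^esub> M) X = (scalars \<inter> carrier SL #>\<^bsub>SL\<^esub> M) \<otimes>\<^bsub>PSL\<^esub> X \<otimes>\<^bsub>PSL\<^esub>
      (scalars \<inter> carrier SL #>\<^bsub>SL\<^esub> inv\<^bsub>GL\<^esub> M)" if "X \<in> carrier PSL" for X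
  proof -
    from that obtain N where N: "X = scalars \<inter> carrier SL #>\<^bsub>SL\<^esub> N" "det N = 1"
      by (auto simp: carrier_PSL)
    moreover have "det (M ** N) = 1"
      by (simp add: det_mul M N)
    ultimately show ?thesis
      by (simp add: PSL_mult PGL_conj_eq A M M')
  qed
  moreover have "PGL_conj C \<in> extensional (carrier PSL)" for C :: "('a ^ 'n ^ 'n) set"
    by (simp add: PGL_conj_def)
  ultimately show ?thesis
    by (intro extensionalityI[where A = "carrier PSL"]) (simp_all add: inner_aut_def)
qed

end

theory Submission
  imports Defs
begin

text \<open>
  Write \<open>q = 3 ^ f\<close> and let \<open>[A]\<close> be the automorphism given by conjugation with a matrix \<open>A\<close>.
  Every element of the coset has the form \<open>[A] \<phi>\<close> with \<open>det A\<close> a nonsquare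
  (lemma \<open>nonsquare_coset_representative\<close>): the determinant of a representative of \<open>g\<close> is a
  nonsquare, and moving an inner factor past \<open>\<phi>\<close> multiplies it by \<open>1\<close>. Since \<open>\<phi>\<close> has order
  \<open>f\<close>, the \<open>f\<close>-th power of \<open>[A] \<phi>\<close> is \<open>[N]\<close>, where \<open>N = A \<phi>(A) \<phi>\<^sup>2(A) \<dots>\<close> is the product
  of the \<open>f\<close> Frobenius conjugates of \<open>A\<close>. It remains to see that \<open>N\<^sup>4\<close> is a scalar matrix. Two
  invariants of \<open>N\<close> decide this.

  \<^item> The trace of \<open>N\<close> lies in the prime field. Applying \<open>\<phi>\<close> permutes the factors of \<open>N\<close>
    cyclically, so \<open>A \<phi>(N) = N A\<close>; thus \<open>\<phi>(N)\<close> is conjugate to \<open>N\<close> and the trace is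
    fixed by cubing (lemma \<open>trace_twisted_power_fixed\<close>).
  \<^item> The determinant of \<open>N\<close> is \<open>det A\<close> to the power
    \<open>1 + 3 + \<dots> + 3 ^ (f - 1) = (q - 1) / 2\<close>, which is \<open>-1\<close> by Euler's criterion
    (lemma \<open>finite_field_Euler\<close>).

  So \<open>N\<^sup>2 = t N + 1\<close> with \<open>t\<^sup>3 = t\<close>, whence \<open>N\<^sup>4 = 3 t N + t\<^sup>2 + 1 = t\<^sup>2 + 1\<close> in
  characteristic three (lemma \<open>fourth_power_scalar\<close>). Behind the computation is the fact that
  \<open>N\<close> behaves like an element of \<open>GL(2,3)\<close> outside \<open>SL(2,3)\<close>, that is, modulo scalars, like an
  odd permutation of four points.
\<close>

section \<open>Matrix classes as automorphisms\<close>

lemma class_in_PGL: "scalars #>\<^bsub>GL\<^esub> A \<in> carrier PGL" if "invertible A" for A :: "'a::field ^ 'n ^ 'n"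
  using that by (auto simp: carrier_PGL)

lemma PGL_conj_class_closed: "PGL_conj (scalars #>\<^bsub>GL\<^esub> A) \<in> carrier (AutoGroup PSL)"
  if "invertible A" for A :: "'a::field ^ 'n ^ 'n"
  unfolding AutoGroup_simps by (rule PGL_conj_auto[OF class_in_PGL[OF that]])

lemma PGL_conj_class_mult:
  fixes A B :: "'a::field ^ 'n ^ 'n"
  assumes "invertible A" "invertible B"
  shows "PGL_conj (scalars #>\<^bsub>GL\<^esub> (A ** B))
    = PGL_conj (scalars #>\<^bsub>GL\<^esub> A) \<otimes>\<^bsub>AutoGroup PSL\<^esub> PGL_conj (scalars #>\<^bsub>GL\<^esub> B)"
  using hom_mult[OF PGL_conj_hom class_in_PGL[OF assms(1)] class_in_PGL[OF assms(2)]] assms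
  by (simp add: PGL_mult)

lemma PGL_conj_scalar: "PGL_conj (scalars #>\<^bsub>GL\<^esub> mat c) = \<one>\<^bsub>AutoGroup (PSL :: ('a ^ 'n ^ 'n) set monoid)\<^esub>"
  if "c \<noteq> 0" for c :: "'a::field"
proof -
  have "scalars #>\<^bsub>GL\<^esub> mat c = (\<one>\<^bsub>PGL\<^esub> :: ('a ^ 'n ^ 'n) set)"
    using group.coset_join2[OF group_GL _ normal_imp_subgroup[OF scalars_normal], of "mat c"] that
    by (auto simp: PGL_def invertible_mat scalars_def)
  then show ?thesis
    using hom_one[OF PGL_conj_hom group_PGL group.AutoGroup[OF group_PSL]] by simp
qed

text \<open>
  Dividing a representative by a square root of its determinant moves it into \<^const>\<open>SL\<close>
  without changing its class. Hence the classes outside \<^const>\<open>PSL\<close> have nonsquare determinant.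
\<close>
lemma square_det_imp_inner:
  fixes A :: "'a::field ^ 2 ^ 2"
  assumes A: "invertible A" and e: "det A = e ^ 2"
  shows "PGL_conj (scalars #>\<^bsub>GL\<^esub> A) \<in> Inn PSL"
proof -
  have "e \<noteq> 0"
    using A e by (auto simp: invertible_det_nz)
  define M where "M = mat (inverse e) ** A"
  have M: "det M = 1"
    using \<open>e \<noteq> 0\<close> e unfolding M_def det_mul
    by (simp add: det_2 mat_def power2_eq_square field_simps)
  have "scalars #>\<^bsub>GL\<^esub> M = scalars #>\<^bsub>GL\<^esub> A"
    using \<open>e \<noteq> 0\<close> A
    by (intro group.repr_independence[OF group_GL _ _ normal_imp_subgroup[OF scalars_normal], symmetric])
      (auto simp: PGL_coset M_def)
  then show ?thesis
    using inner_aut_PSL[OF M] coset_in_PSL[OF M] unfolding Inn_def by (metis imageI)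
qed

section \<open>Matrices and a field automorphism\<close>

locale field_automorphism =
  fixes \<sigma> :: "'a::field \<Rightarrow> 'a"
  assumes bij: "bij \<sigma>" and zero: "\<sigma> 0 = 0" and one: "\<sigma> 1 = 1"
    and add: "\<sigma> (x + y) = \<sigma> x + \<sigma> y" and mult: "\<sigma> (x * y) = \<sigma> x * \<sigma> y"
begin

lemma map_sum: "\<sigma> (sum h I) = (\<Sum>i\<in>I. \<sigma> (h i))"
  by (induction I rule: infinite_finite_induct) (simp_all add: zero add)

lemma map_prod: "\<sigma> (prod h I) = (\<Prod>i\<in>I. \<sigma> (h i))"
  by (induction I rule: infinite_finite_induct) (simp_all add: one mult)

lemma map_minus: "\<sigma> (- x) = - \<sigma> x"
  using add[of x "- x"] by (simp add: zero eq_neg_iff_add_eq_0 add.commute)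

lemma map_matrix_mult: "map_matrix \<sigma> (A ** B) = map_matrix \<sigma> A ** map_matrix \<sigma> B"
  for A B :: "'a ^ 'n ^ 'n"
  by (simp add: vec_eq_iff matrix_matrix_mult_def map_sum mult)

lemma map_matrix_one: "map_matrix \<sigma> (mat 1 :: 'a ^ 'n ^ 'n) = mat 1"
  by (simp add: vec_eq_iff mat_def zero one)

lemma det_map_matrix: "det (map_matrix \<sigma> A) = \<sigma> (det A)" for A :: "'a ^ 'n ^ 'n"
proof -
  have "\<sigma> (of_int (sign p)) = of_int (sign p)" for p :: "'n \<Rightarrow> 'n"
    by (simp add: sign_def map_minus one)
  then show ?thesis
    by (simp add: det_def map_sum map_prod mult)
qed

lemma trace_map_matrix: "trace (map_matrix \<sigma> A) = \<sigma> (trace A)" for A :: "'a ^ 'n ^ 'n"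
  by (simp add: trace_def map_sum)

lemma invertible_map_matrix: "invertible (map_matrix \<sigma> A)" if "invertible A" for A :: "'a ^ 'n ^ 'n"
proof -
  have "\<sigma> (det A) \<noteq> \<sigma> 0"
    using that bij by (metis bij_pointE invertible_det_nz)
  then show ?thesis
    by (simp add: invertible_det_nz det_map_matrix zero)
qed

lemma map_matrix_inv: "map_matrix \<sigma> (inv\<^bsub>GL\<^esub> A) = inv\<^bsub>GL\<^esub> (map_matrix \<sigma> A)"
  if "invertible A" for A :: "'a ^ 'n ^ 'n"
proof (rule group.inv_equality[OF group_GL, symmetric])
  show "map_matrix \<sigma> (inv\<^bsub>GL\<^esub> A) \<otimes>\<^bsub>GL\<^esub> map_matrix \<sigma> A = \<one>\<^bsub>GL\<^esub>"
    using GL_inv(2)[OF that] by (simp add: map_matrix_one flip: map_matrix_mult)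
qed (use that in \<open>simp_all add: invertible_map_matrix GL_inv(1)\<close>)

lemma PSL_field_aut_in_auto: "PSL_field_aut \<sigma> \<in> auto (PSL :: ('a ^ 'n ^ 'n) set monoid)"
  by (rule PSL_field_aut_auto[OF bij zero one add mult])

text \<open>
  The semidirect product relation: a field automorphism normalises the projective linear group
  and acts on it entrywise.
\<close>
lemma PSL_field_aut_conj_commute:
  fixes A :: "'a ^ 'n ^ 'n"
  assumes A: "invertible A"
  shows "PSL_field_aut \<sigma> \<otimes>\<^bsub>AutoGroup PSL\<^esub> PGL_conj (scalars #>\<^bsub>GL\<^esub> A)
    = PGL_conj (scalars #>\<^bsub>GL\<^esub> map_matrix \<sigma> A) \<otimes>\<^bsub>AutoGroup PSL\<^esub> PSL_field_aut \<sigma>"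
proof -
  note \<sigma>A = invertible_map_matrix[OF A]
  note \<sigma>_eq = PSL_field_aut_eq[OF bij zero one add mult]
  note auto = PGL_conj_auto[OF class_in_PGL]
  have "PSL_field_aut \<sigma> (PGL_conj (scalars #>\<^bsub>GL\<^esub> A) X)
      = PGL_conj (scalars #>\<^bsub>GL\<^esub> map_matrix \<sigma> A) (PSL_field_aut \<sigma> X)"
    if "X \<in> carrier PSL" for X
  proof -
    from that obtain M where M: "X = scalars \<inter> carrier SL #>\<^bsub>SL\<^esub> M" "det M = 1"
      by (auto simp: carrier_PSL)
    have "det (A ** M ** inv\<^bsub>GL\<^esub> A) = 1"
      by (simp add: det_conj A M)
    then show ?thesis
      by (simp add: M PGL_conj_eq A \<sigma>A \<sigma>_eq(2,3) map_matrix_mult map_matrix_inv)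
  qed
  then show ?thesis
    by (simp add: AutoGroup_simps PSL_field_aut_in_auto auto A \<sigma>A compose_def cong: restrict_cong)
qed

end


section \<open>Twisted powers\<close>

text \<open>
  The product of \<open>A\<close>, \<open>\<sigma>(A)\<close>, \<open>\<sigma>\<^sup>2(A)\<close>, and so on, with \<open>k\<close> factors: the matrix part of the
  \<open>k\<close>-th power of the semilinear map \<open>A \<sigma>\<close>. When \<open>\<sigma>\<close> has order \<open>k\<close> it is the norm of \<open>A\<close>.
\<close>
primrec twisted_power :: "('a::field \<Rightarrow> 'a) \<Rightarrow> 'a ^ 'n ^ 'n \<Rightarrow> nat \<Rightarrow> 'a ^ 'n ^ 'n" where
  "twisted_power \<sigma> A 0 = mat 1"
| "twisted_power \<sigma> A (Suc k) = A ** map_matrix \<sigma> (twisted_power \<sigma> A k)"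

context field_automorphism
begin

lemma twisted_power_Suc_right:
  "twisted_power \<sigma> A (Suc k) = twisted_power \<sigma> A k ** map_matrix (\<sigma> ^^ k) A" for A :: "'a ^ 'n ^ 'n"
proof (induction k)
  case 0
  show ?case
    by (simp add: map_matrix_one id_def map_matrix_id)
next
  case (Suc k)
  have "twisted_power \<sigma> A (Suc (Suc k))
      = A ** map_matrix \<sigma> (twisted_power \<sigma> A k ** map_matrix (\<sigma> ^^ k) A)"
    by (simp only: Suc twisted_power.simps(2)[of \<sigma> A "Suc k"])
  then show ?case
    by (simp add: map_matrix_mult map_matrix_map_matrix matrix_mul_assoc comp_def)
qed

lemma invertible_twisted_power: "invertible (twisted_power \<sigma> A k)"
  if "invertible A" for A :: "'a ^ 'n ^ 'n"
  by (induction k) (simp_all add: that invertible_mat invertible_mult invertible_map_matrix)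

text \<open>
  If \<open>\<sigma> ^^ k\<close> is the identity, the two recursions for \<open>N = twisted_power \<sigma> A k\<close> give
  \<open>A \<sigma>(N) = N A\<close>. So \<open>\<sigma>(N)\<close> is conjugate to \<open>N\<close> and has the same trace.
\<close>
lemma trace_twisted_power_fixed:
  fixes A :: "'a ^ 'n ^ 'n"
  assumes A: "invertible A" and k: "\<sigma> ^^ k = id"
  shows "\<sigma> (trace (twisted_power \<sigma> A k)) = trace (twisted_power \<sigma> A k)"
proof -
  let ?N = "twisted_power \<sigma> A k"
  have "A ** map_matrix \<sigma> ?N = ?N ** A"
    using twisted_power_Suc_right[of A k] by (simp add: k id_def map_matrix_id)
  then have "inv\<^bsub>GL\<^esub> A ** A ** map_matrix \<sigma> ?N = inv\<^bsub>GL\<^esub> A ** (?N ** A)"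
    by (simp flip: matrix_mul_assoc)
  then have "trace (map_matrix \<sigma> ?N) = trace (?N ** (A ** inv\<^bsub>GL\<^esub> A))"
    using trace_mul_sym[of "inv\<^bsub>GL\<^esub> A" "?N ** A"] by (simp add: GL_inv(2)[OF A] matrix_mul_assoc)
  then show ?thesis
    by (simp add: GL_inv(3)[OF A] trace_map_matrix)
qed

lemma semilinear_power:
  fixes A :: "'a ^ 'n ^ 'n"
  assumes A: "invertible A"
  shows "(PGL_conj (scalars #>\<^bsub>GL\<^esub> A) \<otimes>\<^bsub>AutoGroup PSL\<^esub> PSL_field_aut \<sigma>) [^]\<^bsub>AutoGroup PSL\<^esub> k
    = PGL_conj (scalars #>\<^bsub>GL\<^esub> twisted_power \<sigma> A k)
        \<otimes>\<^bsub>AutoGroup PSL\<^esub> PSL_field_aut \<sigma> [^]\<^bsub>AutoGroup PSL\<^esub> k"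
proof (induction k)
  interpret G: group "AutoGroup (PSL :: ('a ^ 'n ^ 'n) set monoid)"
    by (rule group.AutoGroup[OF group_PSL])
  let ?\<phi> = "PSL_field_aut \<sigma> :: ('a ^ 'n ^ 'n) set \<Rightarrow> ('a ^ 'n ^ 'n) set"
  let ?c = "\<lambda>B :: 'a ^ 'n ^ 'n. PGL_conj (scalars #>\<^bsub>GL\<^esub> B)"
  have \<phi>: "?\<phi> \<in> carrier (AutoGroup PSL)"
    by (simp add: AutoGroup_simps PSL_field_aut_in_auto)
  note c = PGL_conj_class_closed and c_mult = PGL_conj_class_mult
  {
    case 0
    show ?case
      using PGL_conj_scalar[where c = "1 :: 'a" and ?'n = 'n] by simp
  next
    case (Suc k)
    let ?N = "twisted_power \<sigma> A k"
    note N = invertible_twisted_power[OF A, of k]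
    note closed = c[OF A] c[OF N] c[OF invertible_map_matrix[OF N]] \<phi>
    have "(?c A \<otimes>\<^bsub>AutoGroup PSL\<^esub> ?\<phi>) [^]\<^bsub>AutoGroup PSL\<^esub> Suc k
        = ?c A \<otimes>\<^bsub>AutoGroup PSL\<^esub> (?\<phi> \<otimes>\<^bsub>AutoGroup PSL\<^esub> ?c ?N) \<otimes>\<^bsub>AutoGroup PSL\<^esub> ?\<phi> [^]\<^bsub>AutoGroup PSL\<^esub> k"
      unfolding G.nat_pow_Suc2[OF G.m_closed[OF c[OF A] \<phi>]] Suc
      using closed by (simp add: G.m_assoc)
    also have "\<dots> = (?c A \<otimes>\<^bsub>AutoGroup PSL\<^esub> ?c (map_matrix \<sigma> ?N))
        \<otimes>\<^bsub>AutoGroup PSL\<^esub> (?\<phi> \<otimes>\<^bsub>AutoGroup PSL\<^esub> ?\<phi> [^]\<^bsub>AutoGroup PSL\<^esub> k)"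
      unfolding PSL_field_aut_conj_commute[OF N] using closed by (simp add: G.m_assoc)
    also have "\<dots> = ?c (twisted_power \<sigma> A (Suc k)) \<otimes>\<^bsub>AutoGroup PSL\<^esub> ?\<phi> [^]\<^bsub>AutoGroup PSL\<^esub> Suc k"
      unfolding G.nat_pow_Suc2[OF \<phi>] by (simp add: c_mult A invertible_map_matrix[OF N])
    finally show ?case .
  }
qed

end


section \<open>Squares in a finite field of odd order\<close>

text \<open>
  Squaring is at most two-to-one on the \<open>2 m\<close> nonzero elements, so there are at least \<open>m\<close> nonzero
  squares. All of them are roots of \<open>X ^ m - 1\<close>, which has at most \<open>m\<close> roots, so a nonsquare \<open>d\<close>
  is not a root; but \<open>d ^ m\<close> squares to \<open>1\<close>.
\<close>
lemma finite_field_Euler: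
  fixes d :: "'a::finite_field"
  assumes card: "CARD('a) = 2 * m + 1" and d: "d \<noteq> 0" "\<nexists>e. d = e ^ 2"
  shows "d ^ m = - 1"
proof -
  define Q where "Q = (\<lambda>e :: 'a. e ^ 2) ` (UNIV - {0})"
  define p :: "'a poly" where "p = Polynomial.monom 1 m - 1"
  have pow: "e ^ (2 * m) = 1" if "e \<noteq> 0" for e :: 'a
  proof -
    have "e ^ (2 * m) * e = 1 * e"
      using finite_field_power_card_eq_same[of e] by (simp add: card mult.commute)
    with that show ?thesis
      by simp
  qed
  have "m > 0"
    using card card_mono[of UNIV "{0, 1 :: 'a}"] by (cases m) auto
  have "Polynomial.coeff p m = 1"
    using \<open>m > 0\<close> by (simp add: p_def)
  then have "p \<noteq> 0"
    by auto
  have "Polynomial.degree p \<le> m"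
    unfolding p_def by (intro degree_diff_le) (simp_all add: degree_monom_le)
  then have roots: "card {x. poly p x = 0} \<le> m"
    using card_poly_roots_bound[OF \<open>p \<noteq> 0\<close>] by linarith
  have fibre: "card {e \<in> UNIV - {0}. e ^ 2 = y} \<le> 2" for y :: 'a
  proof (cases "\<exists>e. e ^ 2 = y")
    case True
    then obtain e where "e ^ 2 = y" ..
    then have "{e \<in> UNIV - {0}. e ^ 2 = y} \<subseteq> {e, - e}"
      by (auto simp: power2_eq_iff)
    then have "card {e \<in> UNIV - {0}. e ^ 2 = y} \<le> card {e, - e}"
      by (intro card_mono) auto
    also have "\<dots> \<le> 2"
      by (simp add: card_insert_if)
    finally show ?thesis .
  qed auto
  have "2 * m = card (UNIV - {0 :: 'a})"
    by (simp add: card card_Diff_singleton)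
  also have "\<dots> = card (\<Union>y\<in>Q. {e \<in> UNIV - {0}. e ^ 2 = y})"
    by (rule arg_cong[where f = card]) (auto simp: Q_def)
  also have "\<dots> \<le> (\<Sum>y\<in>Q. card {e \<in> UNIV - {0}. e ^ 2 = y})"
    by (rule card_UN_le) simp
  also have "\<dots> \<le> card Q * 2"
    using sum_bounded_above[of Q, OF fibre] by simp
  finally have Q: "m \<le> card Q"
    by simp
  have "Q \<subseteq> {x. poly p x = 0}"
    by (auto simp: Q_def p_def poly_monom pow simp flip: power_mult)
  then have "Q = {x. poly p x = 0}"
    using roots Q by (intro card_seteq) auto
  moreover have "d \<notin> Q"
    using d by (auto simp: Q_def)
  ultimately have "d ^ m \<noteq> 1"
    by (auto simp: p_def poly_monom)
  moreover have "(d ^ m) ^ 2 = 1"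
    using pow[OF d(1)] by (simp add: mult.commute flip: power_mult)
  ultimately show ?thesis
    by (simp add: power2_eq_1_iff)
qed


section \<open>Fourth powers of two by two matrices in characteristic three\<close>

lemma Cayley_Hamilton_2: "N ** N = mat (trace N) ** N - mat (det N)" for N :: "'a::field ^ 2 ^ 2"
  unfolding mat_mult
  by (simp add: vec_eq_iff forall_2 matrix_matrix_mult_def mat_def sum_2 trace_def det_2 algebra_simps)

text \<open>
  With \<open>t\<close> the trace, squaring \<open>N\<^sup>2 = t N + 1\<close> and reducing again gives
  \<open>N\<^sup>4 = (t\<^sup>3 + 2 t) N + t\<^sup>2 + 1\<close>, and \<open>t\<^sup>3 + 2 t = 3 t = 0\<close>.
\<close>
lemma fourth_power_scalar:
  fixes N :: "'a::field ^ 2 ^ 2"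
  assumes three: "(3 :: 'a) = 0" and t: "trace N ^ 3 = trace N" and det: "det N = - 1"
  shows "N ** N ** (N ** N) = mat ((trace N)\<^sup>2 + 1)"
proof -
  define t where "t = trace N"
  have N2: "N ** N = mat t ** N + mat 1"
    unfolding Cayley_Hamilton_2 by (simp add: det t_def vec_eq_iff mat_def)
  have "mat t ** N ** (mat t ** N) = mat (t * t) ** (N ** N)"
    by (metis mat_commute mat_times_mat matrix_mul_assoc)
  also have "\<dots> = mat (t ^ 3) ** N + mat (t\<^sup>2)"
    by (simp add: N2 matrix_add_ldistrib matrix_mul_assoc mat_times_mat power2_eq_square power3_eq_cube)
  also have "\<dots> = mat t ** N + mat (t\<^sup>2)"
    using t by (simp add: t_def)
  finally have tN2: "mat t ** N ** (mat t ** N) = mat t ** N + mat (t\<^sup>2)" .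
  have "N ** N ** (mat t ** N) = mat t ** N ** (N ** N)"
    by (metis mat_commute matrix_mul_assoc)
  also have "\<dots> = mat t ** N ** (mat t ** N) + mat t ** N"
    by (simp add: N2 matrix_add_ldistrib)
  finally have "N ** N ** (N ** N) = mat t ** N ** (mat t ** N) + mat t ** N + (mat t ** N + mat 1)"
    by (subst (2) N2) (simp add: matrix_add_ldistrib N2)
  then have "N ** N ** (N ** N) = mat t ** N + mat t ** N + mat t ** N + (mat (t\<^sup>2) + mat 1)"
    by (simp add: tN2 algebra_simps)
  moreover have "mat t ** N + mat t ** N + mat t ** N = 0"
  proof -
    have "x + x + x = 3 * x" for x :: 'a
      by simp
    then show ?thesis
      by (simp add: vec_eq_iff three del: mult_numeral_left)
  qed
  ultimately have "N ** N ** (N ** N) = mat (t\<^sup>2) + mat 1"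
    by simp
  then show ?thesis
    by (simp add: t_def vec_eq_iff mat_def)
qed


section \<open>The coset of a nonsquare class times the Frobenius automorphism\<close>

lemma det_Frobenius_twisted_power:
  fixes A :: "'a::field ^ 'n ^ 'n"
  assumes "field_automorphism (\<lambda>a :: 'a. a ^ 3)"
  shows "det (twisted_power (\<lambda>a. a ^ 3) A k) = det A ^ (\<Sum>i<k. 3 ^ i)"
proof (induction k)
  case (Suc k)
  have "(\<Sum>i<Suc k. 3 ^ i) = 1 + 3 * (\<Sum>i<k. 3 ^ i :: nat)"
    by (simp add: sum.lessThan_Suc_shift sum_distrib_left del: sum.lessThan_Suc)
  then show ?case
    using Suc
    by (simp add: det_mul field_automorphism.det_map_matrix[OF assms] mult.commute
        del: sum.lessThan_Suc flip: power_mult)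
qed simp

context
  fixes f :: nat and \<phi> :: "('a::finite_field ^ 2 ^ 2) set \<Rightarrow> ('a ^ 2 ^ 2) set"
  assumes f: "f > 0" and card: "CARD('a) = 3 ^ f"
  defines "\<phi> \<equiv> PSL_field_aut (\<lambda>a. a ^ 3)"
begin

lemma Frobenius_field_automorphism: "field_automorphism (\<lambda>a :: 'a. a ^ 3)"
  by unfold_locales (use power_3_hom[OF f card, where k = 1] in simp_all)

text \<open>
  The \<open>f\<close>-th power kills \<open>\<phi>\<close> and leaves the class of a matrix of determinant \<open>-1\<close> with trace in
  the prime field, whose fourth power is scalar.
\<close>
lemma nonsquare_semilinear_power_4f:
  fixes A :: "'a ^ 2 ^ 2"
  assumes nz: "det A \<noteq> 0" and nonsquare: "\<nexists>e. det A = e ^ 2"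
  shows "(PGL_conj (scalars #>\<^bsub>GL\<^esub> A) \<otimes>\<^bsub>AutoGroup PSL\<^esub> \<phi>) [^]\<^bsub>AutoGroup PSL\<^esub> (4 * f) = \<one>\<^bsub>AutoGroup PSL\<^esub>"
proof -
  interpret F: field_automorphism "\<lambda>a :: 'a. a ^ 3"
    by (rule Frobenius_field_automorphism)
  interpret G: group "AutoGroup (PSL :: ('a ^ 2 ^ 2) set monoid)"
    by (rule group.AutoGroup[OF group_PSL])
  let ?c = "\<lambda>B :: 'a ^ 2 ^ 2. PGL_conj (scalars #>\<^bsub>GL\<^esub> B)"
  note c = PGL_conj_class_closed and c_mult = PGL_conj_class_mult
  have A: "invertible A"
    using nz by (simp add: invertible_det_nz)
  have \<phi>: "\<phi> \<in> carrier (AutoGroup PSL)"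
    by (simp add: \<phi>_def AutoGroup_simps F.PSL_field_aut_in_auto)
  have "\<phi> [^]\<^bsub>AutoGroup PSL\<^esub> f = \<one>\<^bsub>AutoGroup PSL\<^esub>"
    using Frobenius_ord[OF f card] G.pow_ord_eq_1[OF \<phi>] by (simp add: \<phi>_def)
  define N where "N = twisted_power (\<lambda>a. a ^ 3) A f"
  have N: "invertible N"
    unfolding N_def by (rule F.invertible_twisted_power[OF A])
  have power_f: "(?c A \<otimes>\<^bsub>AutoGroup PSL\<^esub> \<phi>) [^]\<^bsub>AutoGroup PSL\<^esub> f = ?c N"
    using F.semilinear_power[OF A, of f] \<open>\<phi> [^]\<^bsub>AutoGroup PSL\<^esub> f = _\<close> c[OF N]
    by (simp add: N_def \<phi>_def)
  have "(\<lambda>a :: 'a. a ^ 3) ^^ k = (\<lambda>a. a ^ 3 ^ k)" for k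
    by (induction k) (auto simp: fun_eq_iff mult.commute simp flip: power_mult)
  then have "(\<lambda>a :: 'a. a ^ 3) ^^ f = id"
    using finite_field_power_card_eq_same[where ?'a = 'a] by (simp add: card id_def)
  then have trace: "trace N ^ 3 = trace N"
    using F.trace_twisted_power_fixed[OF A] by (simp add: N_def)
  have "CARD('a) = 2 * (\<Sum>i<f. 3 ^ i) + 1"
    unfolding card by (induction f) simp_all
  from finite_field_Euler[OF this nz nonsquare] have det: "det N = - 1"
    by (simp add: N_def det_Frobenius_twisted_power[OF Frobenius_field_automorphism])
  have three: "(3 :: 'a) = 0"
    using of_nat_CHAR[where ?'a = 'a] by (simp add: CHAR_3[OF f card])
  define s where "s = (trace N)\<^sup>2 + 1"
  have N4: "N ** N ** (N ** N) = mat s"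
    unfolding s_def by (rule fourth_power_scalar[OF three trace det])
  \<comment> \<open>A vanishing scalar would make \<open>N\<close> nilpotent, although its determinant is \<open>-1\<close>.\<close>
  have "s \<noteq> 0"
  proof
    assume "s = 0"
    then have "det (N ** N ** (N ** N)) = 0"
      by (simp add: N4 det_2 mat_def)
    then show False
      by (simp add: det_mul det)
  qed
  have "(?c A \<otimes>\<^bsub>AutoGroup PSL\<^esub> \<phi>) [^]\<^bsub>AutoGroup PSL\<^esub> (4 * f) = ?c N [^]\<^bsub>AutoGroup PSL\<^esub> (4 :: nat)"
    using G.nat_pow_pow[OF G.m_closed[OF c[OF A] \<phi>], of f 4] by (simp add: power_f mult.commute)
  also have "\<dots> = ?c (N ** N ** (N ** N))"
    using c[OF N] by (simp add: c_mult N invertible_mult numeral_eq_Suc G.m_assoc)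
  also have "\<dots> = \<one>\<^bsub>AutoGroup PSL\<^esub>"
    unfolding N4 by (rule PGL_conj_scalar[OF \<open>s \<noteq> 0\<close>])
  finally show ?thesis .
qed

text \<open>
  An inner factor on the right of \<open>\<phi>\<close> is the class of a matrix \<open>M\<close> of determinant \<open>1\<close>. On the left
  of \<open>\<phi>\<close> it becomes the class of \<open>\<phi>(M)\<close>, again of determinant \<open>1\<close>, and is absorbed into the
  representative of \<open>g\<close>.
\<close>
lemma nonsquare_coset_representative:
  fixes g :: "('a ^ 2 ^ 2) set \<Rightarrow> ('a ^ 2 ^ 2) set"
  assumes g: "g \<in> PGL_Aut - Inn PSL"
    and x: "x \<in> (g \<otimes>\<^bsub>AutoGroup PSL\<^esub> \<phi>) <#\<^bsub>AutoGroup PSL\<^esub> Inn PSL"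
  obtains A where "det A \<noteq> 0" "\<nexists>e. det A = e ^ 2"
    "x = PGL_conj (scalars #>\<^bsub>GL\<^esub> A) \<otimes>\<^bsub>AutoGroup PSL\<^esub> \<phi>"
proof -
  interpret F: field_automorphism "\<lambda>a :: 'a. a ^ 3"
    by (rule Frobenius_field_automorphism)
  interpret G: group "AutoGroup (PSL :: ('a ^ 2 ^ 2) set monoid)"
    by (rule group.AutoGroup[OF group_PSL])
  let ?c = "\<lambda>B :: 'a ^ 2 ^ 2. PGL_conj (scalars #>\<^bsub>GL\<^esub> B)"
  note c = PGL_conj_class_closed and c_mult = PGL_conj_class_mult
  have \<phi>: "\<phi> \<in> carrier (AutoGroup PSL)"
    by (simp add: \<phi>_def AutoGroup_simps F.PSL_field_aut_in_auto)
  obtain B where B: "invertible B" "g = ?c B"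
    using g by (auto simp: PGL_Aut_def carrier_PGL)
  obtain M where M: "det M = 1" "x = (g \<otimes>\<^bsub>AutoGroup PSL\<^esub> \<phi>) \<otimes>\<^bsub>AutoGroup PSL\<^esub> ?c M"
    using x by (auto simp: l_coset_def Inn_def carrier_PSL inner_aut_PSL)
  define A where "A = B ** map_matrix (\<lambda>a. a ^ 3) M"
  have M': "invertible M" "invertible (map_matrix (\<lambda>a. a ^ 3) M)"
    using F.invertible_map_matrix det_1_invertible[OF M(1)] by auto
  have "det A = det B"
    by (simp add: A_def det_mul F.det_map_matrix M(1))
  then have "det A \<noteq> 0" "\<nexists>e. det A = e ^ 2"
    using B g square_det_imp_inner[OF B(1)] by (auto simp: invertible_det_nz)
  moreover have "x = ?c B \<otimes>\<^bsub>AutoGroup PSL\<^esub> (\<phi> \<otimes>\<^bsub>AutoGroup PSL\<^esub> ?c M)"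
    using c[OF B(1)] c[OF M'(1)] \<phi> by (simp add: M(2) B(2) G.m_assoc)
  then have "x = ?c A \<otimes>\<^bsub>AutoGroup PSL\<^esub> \<phi>"
    using F.PSL_field_aut_conj_commute[OF M'(1)] c[OF B(1)] c[OF M'(2)] \<phi>
    by (simp add: A_def c_mult B(1) M'(2) G.m_assoc flip: \<phi>_def)
  ultimately show thesis
    by (rule that)
qed

end

theorem proposition14:
  fixes f :: nat
    and S :: "('a::finite_field ^ 2 ^ 2) set monoid"
    and g \<phi> \<alpha> :: "('a ^ 2 ^ 2) set \<Rightarrow> ('a ^ 2 ^ 2) set"
  assumes "f > 0" and "f \<noteq> 1"
    and "CARD('a) = 3 ^ f"
    and "S = PSL"
    and "g \<in> PGL_Aut - Inn S"
    and "\<phi> = PSL_field_aut (\<lambda>a. a ^ 3)"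
    and "\<alpha> = g \<otimes>\<^bsub>AutoGroup S\<^esub> \<phi>"
  shows "\<alpha> \<in> carrier (AutoGroup S)
    \<and> (\<forall>x \<in> \<alpha> <#\<^bsub>AutoGroup S\<^esub> Inn S. group.ord (AutoGroup S) x dvd 4 * f)
    \<and> ((\<exists>k. f = 2 ^ k) \<longrightarrow> (\<forall>x \<in> \<alpha> <#\<^bsub>AutoGroup S\<^esub> Inn S. p_element 2 (AutoGroup S) x))"
proof -
  note f = assms(1) and card = assms(3)
  interpret G: group "AutoGroup S"
    unfolding \<open>S = PSL\<close> by (rule group.AutoGroup[OF group_PSL])
  have \<phi>: "\<phi> \<in> carrier (AutoGroup S)"
    unfolding assms(4,6) AutoGroup_simps by (rule Frobenius_auto[OF f card])
  have conj: "PGL_conj (scalars #>\<^bsub>GL\<^esub> A) \<in> carrier (AutoGroup S)" if "invertible A" for A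
    unfolding assms(4) by (rule PGL_conj_class_closed[OF that])
  have "\<alpha> \<in> carrier (AutoGroup S)"
    using assms(5,7) \<phi> conj by (auto simp: PGL_Aut_def carrier_PGL)
  moreover have coset: "x \<in> carrier (AutoGroup S) \<and> G.ord x dvd 4 * f"
    if "x \<in> \<alpha> <#\<^bsub>AutoGroup S\<^esub> Inn S" for x
  proof -
    have g: "g \<in> PGL_Aut - Inn PSL"
      using assms(4,5) by simp
    have "x \<in> (g \<otimes>\<^bsub>AutoGroup PSL\<^esub> PSL_field_aut (\<lambda>a. a ^ 3)) <#\<^bsub>AutoGroup PSL\<^esub> Inn PSL"
      using that by (simp add: assms(4,6,7))
    from nonsquare_coset_representative[OF f card g this]
    obtain A where A: "det A \<noteq> 0" "\<nexists>e. det A = e ^ 2"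
        "x = PGL_conj (scalars #>\<^bsub>GL\<^esub> A) \<otimes>\<^bsub>AutoGroup S\<^esub> \<phi>"
      unfolding assms(4,6) .
    then have x: "x \<in> carrier (AutoGroup S)"
      using \<phi> conj by (simp add: invertible_det_nz)
    have "x [^]\<^bsub>AutoGroup S\<^esub> (4 * f) = \<one>\<^bsub>AutoGroup S\<^esub>"
      unfolding A(3) assms(4,6) by (rule nonsquare_semilinear_power_4f[OF f card A(1,2)])
    then show ?thesis
      using x G.pow_eq_id[OF x] by simp
  qed
  moreover have "p_element 2 (AutoGroup S) x" if "f = 2 ^ k" "x \<in> \<alpha> <#\<^bsub>AutoGroup S\<^esub> Inn S" for k x
  proof -
    have "G.ord x dvd 2 ^ (k + 2)"
      using coset[OF that(2)] by (simp add: that(1))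
    then show ?thesis
      using coset[OF that(2)] divides_primepow_nat[of 2 "G.ord x" "k + 2"]
      by (auto simp: p_element_def)
  qed
  ultimately show ?thesis
    by blast
qed

end
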